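(* Let $r \geq 2$, let $1 \leq k \leq r-1$, and let $H$ be a $k$-bridgeless $r$-graph. Then $\mathfrak{F}(H)$ is a $k$-tight family.
   Context: An $r$-graph $G$ is a finite simple $r$-uniform hypergraph with vertex set $V(G)$ and edge set $E(G) \subseteq \binom{V(G)}{r}$. $\mathfrak{F}(H)$ is the family of all $r$-graphs that contain no copy of $H$ as a (not necessarily induced) subgraph. A $k$-bridge in an $r$-graph $H$ is an edge $e \in E(H)$ for which there exists a partition $V(H) = A \sqcup B$ such that $e$ is the unique edge of $H$ with the property that $|e \cap A| \geq k$ and $e \cap B \neq \emptyset$. An $r$-graph is $k$-bridged if it has a $k$-bridge, and $k$-bridgeless if it does not. An $r$-graph $G$ is $k$-tight if $E(G) \neq \emptyset$ and, for every $U \subsetneq V(G)$ such that $U$ contains an edge of $G$, there is an edge $e \in E(G)$ such that $k \leq |e \cap U| \leq r-1$. For a family $\mathcal{F}$ of $r$-graphs, $G \in \mathcal{F}$ is edge-maximal (in $\mathcal{F}$) if there is no $G' \in \mathcal{F}$ with $V(G') = V(G)$ and $E(G) \subsetneq E(G')$. The family $\mathcal{F}$ is a $k$-tight family if every edge-maximal $G \in \mathcal{F}$ with $|V(G)| \geq r$ is $k$-tight. *)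

theory Defs
  imports Main "HOL-Library.Ramsey"
begin

record 'a hypergraph =
  verts :: "'a set"
  edges :: "'a set set"

definition r_graph :: "nat \<Rightarrow> 'a hypergraph \<Rightarrow> bool" where
  "r_graph r G \<longleftrightarrow> finite (verts G) \<and> edges G \<subseteq> nsets (verts G) r"

definition contains_copy :: "'b hypergraph \<Rightarrow> 'a hypergraph \<Rightarrow> bool" where
  "contains_copy G H \<longleftrightarrow>
     (\<exists>f. inj_on f (verts H) \<and> f ` verts H \<subseteq> verts G \<and> (\<forall>e\<in>edges H. f ` e \<in> edges G))"

text \<open>The forbidden graph \<open>H\<close> and the members of the family may have vertices of different types,
  so that the vertex type of \<open>H\<close> puts no restriction on the sizes of the members.\<close>

definition free_family :: "nat \<Rightarrow> 'a hypergraph \<Rightarrow> 'b hypergraph set" where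
  "free_family r H = {G. r_graph r G \<and> \<not> contains_copy G H}"

definition k_bridge :: "nat \<Rightarrow> 'a hypergraph \<Rightarrow> 'a set \<Rightarrow> bool" where
  "k_bridge k H e \<longleftrightarrow>
     e \<in> edges H \<and>
     (\<exists>A B. A \<union> B = verts H \<and> A \<inter> B = {} \<and>
        {e' \<in> edges H. k \<le> card (e' \<inter> A) \<and> e' \<inter> B \<noteq> {}} = {e})"

definition k_bridged :: "nat \<Rightarrow> 'a hypergraph \<Rightarrow> bool" where
  "k_bridged k H \<longleftrightarrow> (\<exists>e. k_bridge k H e)"

abbreviation k_bridgeless :: "nat \<Rightarrow> 'a hypergraph \<Rightarrow> bool" where
  "k_bridgeless k H \<equiv> \<not> k_bridged k H"

definition k_tight :: "nat \<Rightarrow> nat \<Rightarrow> 'a hypergraph \<Rightarrow> bool" where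
  "k_tight r k G \<longleftrightarrow>
     edges G \<noteq> {} \<and>
     (\<forall>U. U \<subset> verts G \<and> (\<exists>e\<in>edges G. e \<subseteq> U) \<longrightarrow>
        (\<exists>e\<in>edges G. k \<le> card (e \<inter> U) \<and> card (e \<inter> U) \<le> r - 1))"

definition edge_maximal :: "'a hypergraph set \<Rightarrow> 'a hypergraph \<Rightarrow> bool" where
  "edge_maximal F G \<longleftrightarrow>
     G \<in> F \<and> \<not> (\<exists>G'\<in>F. verts G' = verts G \<and> edges G \<subset> edges G')"

definition k_tight_family :: "nat \<Rightarrow> nat \<Rightarrow> 'a hypergraph set \<Rightarrow> bool" where
  "k_tight_family r k F \<longleftrightarrow>
     (\<forall>G\<in>F. edge_maximal F G \<and> r \<le> card (verts G) \<longrightarrow> k_tight r k G)"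

end

theory Submission imports Defs begin

text \<open>Say that an edge crosses a vertex set \<open>U\<close> if it has at least \<open>k\<close> vertices in \<open>U\<close> and at
  least one outside. Let \<open>G\<close> be edge-maximal and suppose that it is not \<open>k\<close>-tight. Then \<open>V(G)\<close> has
  a proper subset \<open>U\<close> with at least \<open>r - 1\<close> vertices that no edge of \<open>G\<close> crosses: if \<open>G\<close> has edges,
  this is the failure of tightness, and if it has none, any set of \<open>r - 1\<close> vertices will do. Choose
  an \<open>r\<close>-set \<open>S\<close> with \<open>r - 1\<close> vertices in \<open>U\<close> and one outside. As \<open>r - 1 \<ge> k\<close>, the set \<open>S\<close> crosses
  \<open>U\<close>, so it is not an edge of \<open>G\<close>, and by maximality adding it creates a copy of \<open>H\<close>. This copy
  uses \<open>S\<close>, and \<open>S\<close> is the only edge of the enlarged graph that crosses \<open>U\<close>. Pulling \<open>U\<close> back along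
  the copy therefore gives a partition of \<open>V(H)\<close> for which the edge mapped to \<open>S\<close> is a \<open>k\<close>-bridge
  (lemma \<open>k_bridge_of_unique_crossing_edge\<close>), so \<open>H\<close> was not bridgeless.\<close>

text \<open>Being the only edge that crosses a vertex set is inherited by preimages under an injective
  edge-preserving map, since such a map keeps both the size of the part of an edge inside the set and
  the fact that the edge leaves it, and it sends distinct edges to distinct edges.\<close>

lemma k_bridge_of_unique_crossing_edge:
  fixes f :: "'a \<Rightarrow> 'b"
  assumes inj: "inj_on f (verts H)"
    and edges_in_verts: "\<And>e. e \<in> edges H \<Longrightarrow> e \<subseteq> verts H"
    and hom: "\<And>e. e \<in> edges H \<Longrightarrow> f ` e \<in> E"
    and e: "e \<in> edges H"
    and crosses: "k \<le> card (f ` e \<inter> U)" "\<not> f ` e \<subseteq> U"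
    and unique: "\<And>s. s \<in> E \<Longrightarrow> k \<le> card (s \<inter> U) \<Longrightarrow> \<not> s \<subseteq> U \<Longrightarrow> s = f ` e"
  shows "k_bridge k H e"
proof -
  let ?A = "{x \<in> verts H. f x \<in> U}" and ?B = "{x \<in> verts H. f x \<notin> U}"
  have card_pullback: "card (e' \<inter> ?A) = card (f ` e' \<inter> U)" if "e' \<in> edges H" for e'
  proof -
    have "inj_on f (e' \<inter> ?A)"
      using inj by (rule inj_on_subset) auto
    then have "card (f ` (e' \<inter> ?A)) = card (e' \<inter> ?A)"
      by (rule card_image)
    moreover have "f ` (e' \<inter> ?A) = f ` e' \<inter> U"
      using edges_in_verts[OF that] by auto
    ultimately show ?thesis
      by simp
  qed
  have leaves_pullback: "e' \<inter> ?B \<noteq> {} \<longleftrightarrow> \<not> f ` e' \<subseteq> U" if "e' \<in> edges H" for e'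
    using edges_in_verts[OF that] by auto
  have "e' = e" if "e' \<in> edges H" "f ` e' = f ` e" for e'
    using inj_on_image_eq_iff[OF inj edges_in_verts edges_in_verts] that e by blast
  then have "k \<le> card (e' \<inter> ?A) \<and> e' \<inter> ?B \<noteq> {} \<longleftrightarrow> e' = e" if "e' \<in> edges H" for e'
    unfolding card_pullback[OF that] leaves_pullback[OF that]
    using that crosses unique[OF hom[OF that]] by blast
  then have "{e' \<in> edges H. k \<le> card (e' \<inter> ?A) \<and> e' \<inter> ?B \<noteq> {}} = {e}"
    using e by blast
  moreover have "?A \<union> ?B = verts H" "?A \<inter> ?B = {}"
    by auto
  ultimately show ?thesis
    unfolding k_bridge_def using e by blast
qed

lemma edge_maximal_add_edge_contains_copy:
  assumes "edge_maximal (free_family r H) G"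
    and "S \<in> nsets (verts G) r" and "S \<notin> edges G"
  shows "contains_copy \<lparr>verts = verts G, edges = insert S (edges G)\<rparr> H"
proof (rule ccontr)
  let ?G' = "\<lparr>verts = verts G, edges = insert S (edges G)\<rparr>"
  assume "\<not> contains_copy ?G' H"
  moreover have "r_graph r ?G'"
    using assms by (auto simp: edge_maximal_def free_family_def r_graph_def)
  ultimately have "?G' \<in> free_family r H"
    by (simp add: free_family_def)
  moreover have "edges G \<subset> edges ?G'"
    using assms(3) by auto
  ultimately show False
    using assms(1) unfolding edge_maximal_def by (metis hypergraph.select_convs(1))
qed

text \<open>A new edge with \<open>r - 1\<close> vertices in \<open>U\<close> and one outside would create a copy of \<open>H\<close> in which
  it is a bridge, unless some edge of \<open>G\<close> crosses \<open>U\<close> already. Only the size of \<open>U\<close> is bounded,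
  without asking for an edge inside it, so that the lemma can also show that \<open>G\<close> has edges at all.\<close>

lemma edge_maximal_has_crossing_edge:
  assumes "1 \<le> k" and "k \<le> r - 1"
    and H: "r_graph r H" and bridgeless: "k_bridgeless k H"
    and maximal: "edge_maximal (free_family r H) G"
    and U: "U \<subset> verts G" and card_U: "r - 1 \<le> card U"
  shows "\<exists>e\<in>edges G. k \<le> card (e \<inter> U) \<and> \<not> e \<subseteq> U"
proof (rule ccontr)
  assume "\<not> ?thesis"
  then have uncrossed: "s \<notin> edges G" if "k \<le> card (s \<inter> U)" "\<not> s \<subseteq> U" for s
    using that by blast
  have G_free: "\<not> contains_copy G H"
    using maximal by (auto simp: edge_maximal_def free_family_def)
  obtain W where W: "W \<subseteq> U" "card W = r - 1" "finite W"
    using obtain_subset_with_card_n[OF card_U] by metis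
  obtain v where v: "v \<in> verts G" "v \<notin> U"
    using U by blast
  define S where "S = insert v W"
  have "card S = r"
    using W v assms(1,2) by (auto simp: S_def card_insert_if)
  then have S_nset: "S \<in> nsets (verts G) r"
    using W v U by (auto simp: S_def nsets_def)
  have "S \<inter> U = W"
    using W v by (auto simp: S_def)
  then have S_crosses: "k \<le> card (S \<inter> U)" "\<not> S \<subseteq> U"
    using W v assms(2) by (auto simp: S_def)
  have "contains_copy \<lparr>verts = verts G, edges = insert S (edges G)\<rparr> H"
    by (rule edge_maximal_add_edge_contains_copy[OF maximal S_nset uncrossed[OF S_crosses]])
  then obtain f where f: "inj_on f (verts H)" "f ` verts H \<subseteq> verts G"
      and f_edges: "\<forall>e\<in>edges H. f ` e \<in> insert S (edges G)"
    by (auto simp: contains_copy_def simp del: insert_iff)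
  have "contains_copy G H" if "\<forall>e\<in>edges H. f ` e \<in> edges G"
    unfolding contains_copy_def using f that by (intro exI[of _ f]) simp
  then obtain e where "e \<in> edges H" "f ` e \<notin> edges G"
    using G_free by metis
  then have e: "e \<in> edges H" "f ` e = S"
    using f_edges by auto
  have "k_bridge k H e"
  proof (rule k_bridge_of_unique_crossing_edge[where f = f and U = U and E = "insert S (edges G)"])
    show "e' \<subseteq> verts H" if "e' \<in> edges H" for e'
      using H that by (auto simp: r_graph_def nsets_def)
    show "f ` e' \<in> insert S (edges G)" if "e' \<in> edges H" for e'
      using f_edges that by blast
    show "s = f ` e" if "s \<in> insert S (edges G)" "k \<le> card (s \<inter> U)" "\<not> s \<subseteq> U" for s
      using uncrossed that e(2) by blast
  qed (use f(1) e S_crosses in simp_all)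
  then show False
    using bridgeless by (auto simp: k_bridged_def)
qed

theorem theorem1p10:
  fixes r k :: nat and H :: "'a hypergraph"
  assumes "r \<ge> 2"
    and "1 \<le> k" and "k \<le> r - 1"
    and "r_graph r H"
    and "k_bridgeless k H"
  shows "k_tight_family r k (free_family r H :: 'b hypergraph set)"
  unfolding k_tight_family_def
proof (intro ballI impI)
  fix G :: "'b hypergraph"
  assume "G \<in> free_family r H" and "edge_maximal (free_family r H) G \<and> r \<le> card (verts G)"
  then have G: "r_graph r G" and maximal: "edge_maximal (free_family r H) G"
    and card_G: "r \<le> card (verts G)"
    by (auto simp: free_family_def)
  note crossing = edge_maximal_has_crossing_edge[OF assms(2-5) maximal]
  have finite_G: "finite (verts G)"
    using G by (simp add: r_graph_def)
  have edge: "finite e" "card e = r" if "e \<in> edges G" for e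
    using G that by (auto simp: r_graph_def nsets_def)
  show "k_tight r k G"
    unfolding k_tight_def
  proof (intro conjI allI impI)
    have "r - 1 \<le> card (verts G)"
      using card_G by simp
    then obtain U where "U \<subseteq> verts G" "card U = r - 1"
      using obtain_subset_with_card_n by metis
    moreover from this have "U \<noteq> verts G"
      using card_G assms(1) by auto
    ultimately show "edges G \<noteq> {}"
      using crossing[of U] by auto
  next
    fix U assume U: "U \<subset> verts G \<and> (\<exists>e\<in>edges G. e \<subseteq> U)"
    then have "r \<le> card U"
      using edge finite_G by (metis card_mono finite_subset psubset_imp_subset)
    then obtain e where e: "e \<in> edges G" "k \<le> card (e \<inter> U)" "\<not> e \<subseteq> U"
      using crossing[of U] U by (meson diff_le_self le_trans)
    have "card (e \<inter> U) < r"
      using psubset_card_mono[of e "e \<inter> U"] edge[OF e(1)] e(3) by auto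
    then show "\<exists>e\<in>edges G. k \<le> card (e \<inter> U) \<and> card (e \<inter> U) \<le> r - 1"
      using e by (intro bexI[of _ e]) auto
  qed
qed

end
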